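(* For every $n\ge 2$ there exists an asynchronous mutual search algorithm for two agents on $n$ sites with cost at most $\frac{5-\sqrt{2}}{4}\,n$ (approximately $0.896n$).
   Context: An asynchronous mutual search (AMS) algorithm for two agents on sites $V=\{0,\ldots,n-1\}$ consists of a tournament $(V,E)$ ($E$ contains, for each unordered pair $\{i,j\}$ of distinct sites, exactly one of the arcs $(i,j)$, $(j,i)$; arc $(i,j)$ means that an agent at $i$ queries $j$) together with, for each site $i$, a total order on its row $E_i$ (the set of arcs leaving $i$), giving the order in which an agent at $i$ makes its queries; arcs in different rows are not ordered relative to each other. The cost of an arc $e=(i,j)\in E_i$ is its position in the order of $E_i$ (the first arc of the row having position $1$) plus the length $|E_j|$ of the row of its target. The cost of the AMS algorithm is the maximum cost over all its arcs. *)

theory Defs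
  imports Complex_Main
begin

definition tournament :: "'a set \<Rightarrow> ('a \<times> 'a) set \<Rightarrow> bool" where
  "tournament V E \<longleftrightarrow>
     E \<subseteq> V \<times> V \<and> irrefl E \<and>
     (\<forall>i\<in>V. \<forall>j\<in>V. i \<noteq> j \<longrightarrow> ((i, j) \<in> E \<longleftrightarrow> (j, i) \<notin> E))"

definition row :: "('a \<times> 'a) set \<Rightarrow> 'a \<Rightarrow> ('a \<times> 'a) set" where
  "row E i = {e \<in> E. fst e = i}"

text \<open>
  The relation \<open>R i\<close> is the reflexive total order on the row of \<open>i\<close>:
  \<open>(e, e') \<in> R i\<close> means that an agent at \<open>i\<close> makes the query \<open>e\<close> no later than \<open>e'\<close>.
  As \<^const>\<open>linear_order_on\<close> includes \<open>R i \<subseteq> row E i \<times> row E i\<close>, arcs of different rows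
  are never compared.
\<close>

definition ams_algorithm ::
    "nat \<Rightarrow> (nat \<times> nat) set \<Rightarrow> (nat \<Rightarrow> (nat \<times> nat) rel) \<Rightarrow> bool" where
  "ams_algorithm n E R \<longleftrightarrow>
     tournament {..<n} E \<and> (\<forall>i<n. linear_order_on (row E i) (R i))"

definition arc_position :: "('a \<times> 'a) set \<Rightarrow> ('a \<Rightarrow> ('a \<times> 'a) rel) \<Rightarrow> 'a \<times> 'a \<Rightarrow> nat" where
  "arc_position E R e = card {e' \<in> row E (fst e). (e', e) \<in> R (fst e)}"

definition arc_cost :: "('a \<times> 'a) set \<Rightarrow> ('a \<Rightarrow> ('a \<times> 'a) rel) \<Rightarrow> 'a \<times> 'a \<Rightarrow> nat" where
  "arc_cost E R e = arc_position E R e + card (row E (snd e))"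

text \<open>The maximum is meaningful since a tournament on at least two sites has an arc.\<close>

definition ams_cost :: "('a \<times> 'a) set \<Rightarrow> ('a \<Rightarrow> ('a \<times> 'a) rel) \<Rightarrow> nat" where
  "ams_cost E R = Max (arc_cost E R ` E)"

end

theory Submission
  imports Defs
begin

text \<open>
  Let \<open>m = (n - 3) div 7\<close>. The sites below \<open>6m+3\<close> carry the parity tournament, in which every site
  beats half of every initial segment, up to rounding; the remaining sites are ordered transitively.
  The first \<open>4m+2\<close> sites (the head) beat all transitive sites, and these beat the \<open>2m+1\<close> sites
  in between (the tail). Every site queries its targets in increasing order. Long rows belong to the
  head, whose sites are queried early: at most half of them precede a given query. Along the
  transitive sites the position of a query grows exactly as fast as the row of its target shrinks.
  All costs are at most \<open>n - 1 - m\<close>, which is asymptotically \<open>6n/7\<close>.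
\<close>

lemma ams_from_increasing_queries:
  fixes A :: "nat \<Rightarrow> nat \<Rightarrow> bool"
  assumes n: "n \<ge> 2"
    and irr: "\<And>i. \<not> A i i"
    and tot: "\<And>i j. i < n \<Longrightarrow> j < n \<Longrightarrow> i \<noteq> j \<Longrightarrow> A i j \<longleftrightarrow> \<not> A j i"
    and cost: "\<And>i j. i < n \<Longrightarrow> j < n \<Longrightarrow> A i j \<Longrightarrow>
                 card {k. k \<le> j \<and> A i k} + card {k. k < n \<and> A j k} \<le> C"
  shows "\<exists>E R. ams_algorithm n E R \<and> ams_cost E R \<le> C"
proof -
  define E where "E = {(i, j). i < n \<and> j < n \<and> A i j}"
  define R where "R = (\<lambda>i. {(e, e'). e \<in> row E i \<and> e' \<in> row E i \<and> snd e \<le> snd e'})"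
  have "tournament {..<n} E"
    unfolding tournament_def
  proof (intro conjI ballI impI)
    fix i j
    assume "i \<in> {..<n}" "j \<in> {..<n}" "i \<noteq> j"
    then show "(i, j) \<in> E \<longleftrightarrow> (j, i) \<notin> E"
      using tot[of i j] by (simp add: E_def)
  qed (auto simp: E_def irrefl_def irr)
  moreover have "linear_order_on (row E i) (R i)" for i
    unfolding linear_order_on_def partial_order_on_def preorder_on_def refl_on_def trans_def
      antisym_def total_on_def R_def
    by (auto simp: row_def)
  ultimately have alg: "ams_algorithm n E R"
    by (simp add: ams_algorithm_def)
  have row: "row E j = Pair j ` {k. k < n \<and> A j k}" if "j < n" for j
    using that by (auto simp: row_def E_def)
  have "arc_cost E R e \<le> C" if eE: "e \<in> E" for e
  proof -
    obtain i j where e: "e = (i, j)" and ij: "i < n" "j < n" "A i j"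
      using eE by (auto simp: E_def)
    have "{e' \<in> row E i. (e', e) \<in> R i} = Pair i ` {k. k \<le> j \<and> A i k}"
      using ij by (auto simp: row_def E_def R_def e)
    then have "arc_position E R e = card {k. k \<le> j \<and> A i k}"
      by (simp add: arc_position_def e card_image inj_on_def)
    moreover have "card (row E j) = card {k. k < n \<and> A j k}"
      using ij by (simp add: row card_image inj_on_def)
    ultimately show ?thesis
      using cost[OF ij] by (simp add: arc_cost_def e)
  qed
  moreover have "finite E"
    by (rule finite_subset[of _ "{..<n} \<times> {..<n}"]) (auto simp: E_def)
  moreover have "(0, 1) \<in> E \<or> (1, 0) \<in> E"
    using tot[of 0 1] n by (auto simp: E_def)
  then have "E \<noteq> {}" by blast
  ultimately have "ams_cost E R \<le> C"
    by (simp add: ams_cost_def)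
  with alg show ?thesis by blast
qed

definition parity_arc :: "nat \<Rightarrow> nat \<Rightarrow> bool" where
  "parity_arc i j \<longleftrightarrow> i < j \<and> odd (i + j) \<or> j < i \<and> even (i + j)"

lemma parity_arc_total: "i \<noteq> j \<Longrightarrow> parity_arc i j \<longleftrightarrow> \<not> parity_arc j i"
  by (cases i j rule: linorder_cases) (simp_all add: parity_arc_def add.commute)

lemma card_parity_arc_prefix:
  "card {k. k < y \<and> parity_arc i k} =
     (if y \<le> i then if even i then (y + 1) div 2 else y div 2
      else if even i then y div 2 else (y - 1) div 2)"
proof (induction y)
  case 0
  then show ?case by simp
next
  case (Suc y)
  have "{k. k < Suc y \<and> parity_arc i k} =
      (if parity_arc i y then insert y {k. k < y \<and> parity_arc i k}
       else {k. k < y \<and> parity_arc i k})"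
    by (auto simp: less_Suc_eq)
  then have "card {k. k < Suc y \<and> parity_arc i k} =
      card {k. k < y \<and> parity_arc i k} + (if parity_arc i y then 1 else 0)"
    by simp
  also have "\<dots> = (if Suc y \<le> i then if even i then (Suc y + 1) div 2 else Suc y div 2
      else if even i then Suc y div 2 else (Suc y - 1) div 2)"
  proof (cases y i rule: linorder_cases)
    case less
    then show ?thesis
      unfolding Suc.IH unfolding parity_arc_def
      by (cases "even i"; cases "even y") (auto elim!: oddE)
  next
    case equal
    then show ?thesis
      unfolding Suc.IH unfolding parity_arc_def
      by (cases "even i") (auto elim!: oddE)
  next
    case greater
    then show ?thesis
      unfolding Suc.IH unfolding parity_arc_def
      by (cases "even i"; cases "even y") (auto elim!: oddE)
  qed
  finally show ?case .
qed

definition search_arc :: "nat \<Rightarrow> nat \<Rightarrow> nat \<Rightarrow> bool" where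
  "search_arc m i j \<longleftrightarrow>
     i < 6 * m + 3 \<and> j < 6 * m + 3 \<and> parity_arc i j \<or>
     i < 4 * m + 2 \<and> 6 * m + 3 \<le> j \<or>
     6 * m + 3 \<le> i \<and> 4 * m + 2 \<le> j \<and> j < 6 * m + 3 \<or>
     6 * m + 3 \<le> i \<and> i < j"

lemma search_arc_irrefl: "\<not> search_arc m i i"
  by (auto simp: search_arc_def parity_arc_def)

lemma search_arc_total: "i \<noteq> j \<Longrightarrow> search_arc m i j \<longleftrightarrow> \<not> search_arc m j i"
  using parity_arc_total[of i j] unfolding search_arc_def
  by (cases "i < 6 * m + 3"; cases "j < 6 * m + 3"; auto)

lemma card_parity_arc_le: "card {k. k < y \<and> parity_arc i k} \<le> (y + 1) div 2"
  by (auto simp: card_parity_arc_prefix)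

lemma card_parity_arc_full: "i < 6 * m + 3 \<Longrightarrow> card {k. k < 6 * m + 3 \<and> parity_arc i k} = 3 * m + 1"
  by (auto simp: card_parity_arc_prefix)

lemma search_arc_cost:
  assumes n: "7 * m + 3 \<le> n" and ij: "i < n" "j < n" and arc: "search_arc m i j"
  shows "card {k. k \<le> j \<and> search_arc m i k} + card {k. k < n \<and> search_arc m j k} \<le> n - 1 - m"
    (is "card ?P + card ?O \<le> _")
proof -
  let ?a = "6 * m + 3"
  consider (head) "i < ?a" "j < 4 * m + 2" | (tail) "i < ?a" "4 * m + 2 \<le> j" "j < ?a"
    | (head_trans) "i < ?a" "?a \<le> j" | (trans_tail) "?a \<le> i" "4 * m + 2 \<le> j" "j < ?a"
    | (trans_trans) "?a \<le> i" "i < j"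
    using arc by (cases "j < 4 * m + 2") (auto simp: search_arc_def)
  then show ?thesis
  proof cases
    case head
    have "card ?P \<le> card {k. k < 4 * m + 2 \<and> parity_arc i k}"
      using head by (intro card_mono) (auto simp: search_arc_def)
    also have "\<dots> \<le> 2 * m + 1"
      using card_parity_arc_le[of "4 * m + 2" i] by simp
    finally have "card ?P \<le> 2 * m + 1" .
    moreover have "card ?O \<le> card ({k. k < ?a \<and> parity_arc j k} \<union> {?a..<n})"
      using head by (intro card_mono) (auto simp: search_arc_def)
    then have "card ?O \<le> 3 * m + 1 + (n - ?a)"
      using card_Un_le[of "{k. k < ?a \<and> parity_arc j k}" "{?a..<n}"] head
      by (simp add: card_parity_arc_full)
    ultimately show ?thesis using n by linarith
  next
    case tail
    have "card ?P \<le> card {k. k < ?a \<and> parity_arc i k}"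
      using tail by (intro card_mono) (auto simp: search_arc_def)
    moreover have "card ?O \<le> card {k. k < ?a \<and> parity_arc j k}"
      using tail by (intro card_mono) (auto simp: search_arc_def)
    ultimately show ?thesis using n tail by (simp add: card_parity_arc_full)
  next
    case head_trans
    have "card ?P \<le> card ({k. k < ?a \<and> parity_arc i k} \<union> {?a..j})"
      using head_trans by (intro card_mono) (auto simp: search_arc_def)
    then have "card ?P \<le> 3 * m + 1 + (j + 1 - ?a)"
      using card_Un_le[of "{k. k < ?a \<and> parity_arc i k}" "{?a..j}"] head_trans
      by (simp add: card_parity_arc_full)
    moreover have "card ?O \<le> card ({4 * m + 2..<?a} \<union> {j<..<n})"
      using head_trans by (intro card_mono) (auto simp: search_arc_def)
    then have "card ?O \<le> 2 * m + 1 + (n - 1 - j)"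
      using card_Un_le[of "{4 * m + 2..<?a}" "{j<..<n}"] by simp
    ultimately show ?thesis using n head_trans ij by linarith
  next
    case trans_tail
    have "card ?P \<le> card {4 * m + 2..<?a}"
      using trans_tail by (intro card_mono) (auto simp: search_arc_def)
    moreover have "card ?O \<le> card {k. k < ?a \<and> parity_arc j k}"
      using trans_tail by (intro card_mono) (auto simp: search_arc_def)
    ultimately show ?thesis using n trans_tail by (simp add: card_parity_arc_full)
  next
    case trans_trans
    have "card ?P \<le> card ({4 * m + 2..<?a} \<union> {i<..j})"
      using trans_trans by (intro card_mono) (auto simp: search_arc_def)
    then have "card ?P \<le> 2 * m + 1 + (j - i)"
      using card_Un_le[of "{4 * m + 2..<?a}" "{i<..j}"] by simp
    moreover have "card ?O \<le> card ({4 * m + 2..<?a} \<union> {j<..<n})"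
      using trans_trans by (intro card_mono) (auto simp: search_arc_def)
    then have "card ?O \<le> 2 * m + 1 + (n - 1 - j)"
      using card_Un_le[of "{4 * m + 2..<?a}" "{j<..<n}"] by simp
    ultimately show ?thesis using n trans_trans ij by linarith
  qed
qed

theorem theorem3:
  fixes n :: nat
  assumes "n \<ge> 2"
  shows "\<exists>E R. ams_algorithm n E R \<and> real (ams_cost E R) \<le> (5 - sqrt 2) / 4 * real n"
proof -
  have sqrt2: "sqrt 2 < 1.415"
    by (rule real_less_lsqrt) (auto simp: power2_eq_square)
  have "\<exists>C. (\<exists>E R. ams_algorithm n E R \<and> ams_cost E R \<le> C) \<and> real C \<le> 0.89625 * real n"
  proof (cases "n = 2")
    case True
    have "\<exists>E R. ams_algorithm n E R \<and> ams_cost E R \<le> 1"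
    proof (rule ams_from_increasing_queries[where A = "(<)"])
      fix i j :: nat
      assume "i < n" "j < n" "i < j"
      then have "i = 0" "j = 1" using True by auto
      moreover have "{k::nat. k \<le> 1 \<and> 0 < k} = {1}" "{k. k < n \<and> 1 < k} = {}"
        using True by auto
      ultimately show "card {k. k \<le> j \<and> i < k} + card {k. k < n \<and> j < k} \<le> 1"
        by simp
    qed (use assms in auto)
    with True show ?thesis by (intro exI[of _ 1]) simp
  next
    case False
    define m where "m = (n - 3) div 7"
    have m: "7 * m + 3 \<le> n" "n \<le> 7 * m + 9"
      using assms False unfolding m_def by linarith+
    have "\<exists>E R. ams_algorithm n E R \<and> ams_cost E R \<le> n - 1 - m"
      by (rule ams_from_increasing_queries[OF assms, where A = "search_arc m"])
         (use search_arc_irrefl search_arc_total search_arc_cost[OF m(1)] in blast)+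
    moreover have "real (n - 1 - m) = real n - 1 - real m"
      using m by linarith
    moreover have "real n \<le> 7 * real m + 9"
      using m(2) by linarith
    ultimately show ?thesis
      by (intro exI[of _ "n - 1 - m"]) simp
  qed
  then obtain C E R where "ams_algorithm n E R" "ams_cost E R \<le> C" "real C \<le> 0.89625 * real n"
    by blast
  moreover have "0.89625 * real n \<le> (5 - sqrt 2) / 4 * real n"
    using sqrt2 by (intro mult_right_mono) auto
  ultimately show ?thesis
    by (meson of_nat_mono order_trans)
qed

end
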